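(* Let $(M,g)$ and $(N,h)$ be Riemannian manifolds and let $\varphi:(M,g)\to\mathbb{R}^n$ and $\psi:(N,h)\to\mathbb{R}^n$ be two infinity-harmonic maps into Euclidean space. Then their direct sum $\varphi\oplus\psi:(M\times N,g+h)\to\mathbb{R}^n$, defined by $(\varphi\oplus\psi)(p,q)=\varphi(p)+\psi(q)$, is an infinity-harmonic map.
   Context: A $C^2$ map $\psi:(M,g)\to(N,h)$ between Riemannian manifolds is infinity-harmonic if $\frac12\, d\psi(\mathrm{grad}\,|d\psi|^2)=0$, where $|d\psi|_x^2=\sum_i h(d\psi(e_i),d\psi(e_i))$ for an orthonormal basis $\{e_i\}$ of $T_xM$. Here $g+h$ is the product metric. *)

theory Defs
  imports "HOL-Analysis.Analysis"
begin

section \<open>Continuously differentiable functions\<close>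

text \<open>Only used for open sets.\<close>

fun Ck_on :: "nat \<Rightarrow> 'e::real_normed_vector set \<Rightarrow> ('e \<Rightarrow> 'f::real_normed_vector) \<Rightarrow> bool" where
  "Ck_on 0 S f \<longleftrightarrow> continuous_on S f"
| "Ck_on (Suc k) S f \<longleftrightarrow>
     (\<forall>x\<in>S. f differentiable (at x)) \<and>
     (\<forall>v. Ck_on k S (\<lambda>x. frechet_derivative f (at x) v))"

definition smooth_on :: "'e::real_normed_vector set \<Rightarrow> ('e \<Rightarrow> 'f::real_normed_vector) \<Rightarrow> bool" where
  "smooth_on S f \<longleftrightarrow> (\<forall>k. Ck_on k S f)"


section \<open>Smooth manifolds\<close>

text \<open>A chart is a pair of its domain and its coordinate map; the values of the coordinate
  map outside the domain are irrelevant. The model space is an arbitrary Euclidean space, so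
  that the model space of a product manifold is the product of the model spaces. Atlases are
  not required to be maximal.\<close>

type_synonym ('a, 'e) chart = "'a set \<times> ('a \<Rightarrow> 'e)"

record ('a, 'e) mfd =
  mtop :: "'a topology"
  atlas :: "('a, 'e) chart set"

definition chart_inv :: "('a, 'e) chart \<Rightarrow> 'e \<Rightarrow> 'a" where
  "chart_inv c = inv_into (fst c) (snd c)"

definition transition :: "('a, 'e) chart \<Rightarrow> ('a, 'e) chart \<Rightarrow> 'e \<Rightarrow> 'e" where
  "transition c c' = snd c' \<circ> chart_inv c"

definition smooth_manifold :: "('a, 'e::euclidean_space) mfd \<Rightarrow> bool" where
  "smooth_manifold M \<longleftrightarrow>
     Hausdorff_space (mtop M) \<and> second_countable (mtop M) \<and>
     (\<Union>c\<in>atlas M. fst c) = topspace (mtop M) \<and>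
     (\<forall>c\<in>atlas M. openin (mtop M) (fst c) \<and> open (snd c ` fst c) \<and>
        homeomorphic_map (subtopology (mtop M) (fst c)) (top_of_set (snd c ` fst c)) (snd c)) \<and>
     (\<forall>c\<in>atlas M. \<forall>c'\<in>atlas M. smooth_on (snd c ` (fst c \<inter> fst c')) (transition c c'))"

definition Ck_map ::
  "nat \<Rightarrow> ('a, 'e::euclidean_space) mfd \<Rightarrow> ('b, 'f::euclidean_space) mfd \<Rightarrow> ('a \<Rightarrow> 'b) \<Rightarrow> bool" where
  "Ck_map k M N f \<longleftrightarrow>
     continuous_map (mtop M) (mtop N) f \<and>
     (\<forall>c\<in>atlas M. \<forall>d\<in>atlas N.
        Ck_on k (snd c ` {p \<in> fst c. f p \<in> fst d}) (snd d \<circ> f \<circ> chart_inv c))"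


section \<open>Tangent vectors and differentials\<close>

definition charts_at :: "('a, 'e) mfd \<Rightarrow> 'a \<Rightarrow> ('a, 'e) chart set" where
  "charts_at M p = {c \<in> atlas M. p \<in> fst c}"

text \<open>A tangent vector at \<open>p\<close> assigns to every chart around \<open>p\<close> a coordinate vector, such that
  the coordinate vectors transform by the derivatives of the transition maps; it is 0 on all
  other charts. Linear operations on tangent vectors are pointwise.\<close>

type_synonym ('a, 'e) tvec = "('a, 'e) chart \<Rightarrow> 'e"

definition tangent_space :: "('a, 'e::euclidean_space) mfd \<Rightarrow> 'a \<Rightarrow> ('a, 'e) tvec set" where
  "tangent_space M p =
     {v. (\<forall>c. c \<notin> charts_at M p \<longrightarrow> v c = 0) \<and>
         (\<forall>c\<in>charts_at M p. \<forall>c'\<in>charts_at M p.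
            v c' = frechet_derivative (transition c c') (at (snd c p)) (v c))}"

text \<open>The tangent vector at \<open>p\<close> with coordinate vector \<open>x\<close> in the chart \<open>c\<close>.\<close>

definition coord_tvec ::
  "('a, 'e::euclidean_space) mfd \<Rightarrow> ('a, 'e) chart \<Rightarrow> 'a \<Rightarrow> 'e \<Rightarrow> ('a, 'e) tvec" where
  "coord_tvec M c p x =
     (\<lambda>c'. if c' \<in> charts_at M p
           then frechet_derivative (transition c c') (at (snd c p)) x else 0)"

text \<open>The differential of a vector-valued function, computed in some chart around \<open>p\<close>
  (all charts give the same value if the function is differentiable at \<open>p\<close>).\<close>

definition vdiff ::
  "('a, 'e::euclidean_space) mfd \<Rightarrow> ('a \<Rightarrow> 'f::real_normed_vector) \<Rightarrow> 'a \<Rightarrow> ('a, 'e) tvec \<Rightarrow> 'f" where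
  "vdiff M f p v =
     (let c = SOME c. c \<in> charts_at M p
      in frechet_derivative (f \<circ> chart_inv c) (at (snd c p)) (v c))"

definition mdiff ::
  "('a, 'e::euclidean_space) mfd \<Rightarrow> ('b, 'f::euclidean_space) mfd \<Rightarrow> ('a \<Rightarrow> 'b) \<Rightarrow> 'a \<Rightarrow>
   ('a, 'e) tvec \<Rightarrow> ('b, 'f) tvec" where
  "mdiff M N f p v = (\<lambda>d. if d \<in> charts_at N (f p) then vdiff M (snd d \<circ> f) p v else 0)"


section \<open>Riemannian manifolds\<close>

type_synonym ('a, 'e) metric = "'a \<Rightarrow> ('a, 'e) tvec \<Rightarrow> ('a, 'e) tvec \<Rightarrow> real"

definition inner_product_on ::
  "('c \<Rightarrow> 'e::real_vector) set \<Rightarrow> (('c \<Rightarrow> 'e) \<Rightarrow> ('c \<Rightarrow> 'e) \<Rightarrow> real) \<Rightarrow> bool" where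
  "inner_product_on V b \<longleftrightarrow>
     (\<forall>u\<in>V. \<forall>v\<in>V. b u v = b v u) \<and>
     (\<forall>a. \<forall>u\<in>V. \<forall>v\<in>V. \<forall>w\<in>V. b (\<lambda>c. a *\<^sub>R u c + v c) w = a * b u w + b v w) \<and>
     (\<forall>u\<in>V. u \<noteq> (\<lambda>_. 0) \<longrightarrow> b u u > 0)"

definition smooth_metric :: "('a, 'e::euclidean_space) mfd \<Rightarrow> ('a, 'e) metric \<Rightarrow> bool" where
  "smooth_metric M g \<longleftrightarrow>
     (\<forall>c\<in>atlas M. \<forall>x y. smooth_on (snd c ` fst c)
        (\<lambda>z. let p = chart_inv c z in g p (coord_tvec M c p x) (coord_tvec M c p y)))"

definition riemannian_manifold :: "('a, 'e::euclidean_space) mfd \<Rightarrow> ('a, 'e) metric \<Rightarrow> bool" where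
  "riemannian_manifold M g \<longleftrightarrow>
     smooth_manifold M \<and>
     (\<forall>p\<in>topspace (mtop M). inner_product_on (tangent_space M p) (g p)) \<and>
     smooth_metric M g"

definition orthonormal_basis ::
  "('a, 'e::euclidean_space) mfd \<Rightarrow> ('a, 'e) metric \<Rightarrow> 'a \<Rightarrow> ('a, 'e) tvec set \<Rightarrow> bool" where
  "orthonormal_basis M g p B \<longleftrightarrow>
     finite B \<and> B \<subseteq> tangent_space M p \<and>
     (\<forall>u\<in>B. \<forall>v\<in>B. g p u v = (if u = v then 1 else 0)) \<and>
     (\<forall>v\<in>tangent_space M p. \<exists>a. v = (\<lambda>c. \<Sum>u\<in>B. a u *\<^sub>R u c))"

definition gradient ::
  "('a, 'e::euclidean_space) mfd \<Rightarrow> ('a, 'e) metric \<Rightarrow> ('a \<Rightarrow> real) \<Rightarrow> 'a \<Rightarrow> ('a, 'e) tvec" where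
  "gradient M g f p =
     (THE v. v \<in> tangent_space M p \<and> (\<forall>w\<in>tangent_space M p. g p v w = vdiff M f p w))"


section \<open>Infinity-harmonic maps\<close>

text \<open>The squared norm of the differential does not depend on the choice of the
  orthonormal basis.\<close>

definition norm2_diff ::
  "('a, 'e::euclidean_space) mfd \<Rightarrow> ('a, 'e) metric \<Rightarrow>
   ('b, 'f::euclidean_space) mfd \<Rightarrow> ('b, 'f) metric \<Rightarrow> ('a \<Rightarrow> 'b) \<Rightarrow> 'a \<Rightarrow> real" where
  "norm2_diff M g N h f p =
     (let B = SOME B. orthonormal_basis M g p B
      in \<Sum>e\<in>B. h (f p) (mdiff M N f p e) (mdiff M N f p e))"

definition infinity_harmonic ::
  "('a, 'e::euclidean_space) mfd \<Rightarrow> ('a, 'e) metric \<Rightarrow>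
   ('b, 'f::euclidean_space) mfd \<Rightarrow> ('b, 'f) metric \<Rightarrow> ('a \<Rightarrow> 'b) \<Rightarrow> bool" where
  "infinity_harmonic M g N h f \<longleftrightarrow>
     Ck_map 2 M N f \<and>
     (\<forall>p\<in>topspace (mtop M).
        (\<lambda>d. (1/2) *\<^sub>R mdiff M N f p (gradient M g (norm2_diff M g N h f) p) d) = (\<lambda>_. 0))"


section \<open>Products and Euclidean spaces\<close>

definition prod_chart :: "('a, 'e) chart \<Rightarrow> ('b, 'f) chart \<Rightarrow> ('a \<times> 'b, 'e \<times> 'f) chart" where
  "prod_chart c d = (fst c \<times> fst d, map_prod (snd c) (snd d))"

definition prod_mfd :: "('a, 'e) mfd \<Rightarrow> ('b, 'f) mfd \<Rightarrow> ('a \<times> 'b, 'e \<times> 'f) mfd" where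
  "prod_mfd M N =
     \<lparr>mtop = prod_topology (mtop M) (mtop N),
      atlas = {prod_chart c d |c d. c \<in> atlas M \<and> d \<in> atlas N}\<rparr>"

definition prod_rmetric ::
  "('a, 'e::euclidean_space) mfd \<Rightarrow> ('a, 'e) metric \<Rightarrow>
   ('b, 'f::euclidean_space) mfd \<Rightarrow> ('b, 'f) metric \<Rightarrow> ('a \<times> 'b, 'e \<times> 'f) metric" where
  "prod_rmetric M g N h = (\<lambda>p u v.
     g (fst p) (mdiff (prod_mfd M N) M fst p u) (mdiff (prod_mfd M N) M fst p v) +
     h (snd p) (mdiff (prod_mfd M N) N snd p u) (mdiff (prod_mfd M N) N snd p v))"

definition euclidean_mfd :: "('e::euclidean_space, 'e) mfd" where
  "euclidean_mfd = \<lparr>mtop = euclidean, atlas = {(UNIV, id)}\<rparr>"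

definition euclidean_rmetric :: "('e::euclidean_space, 'e) metric" where
  "euclidean_rmetric = (\<lambda>p u v. u (UNIV, id) \<bullet> v (UNIV, id))"

definition direct_sum :: "('a \<Rightarrow> 'v::plus) \<Rightarrow> ('b \<Rightarrow> 'v) \<Rightarrow> 'a \<times> 'b \<Rightarrow> 'v" where
  "direct_sum f k = (\<lambda>(p, q). f p + k q)"

end

theory Submission
  imports Defs
begin

text \<open>The energy density of the direct sum is the sum of the energy densities: the tangent space
  of the product at \<open>(p, q)\<close> is the \<open>g + h\<close>-orthogonal sum of the tangent spaces at \<open>p\<close> and \<open>q\<close>,
  so the union of an orthonormal basis of each factor is an orthonormal basis of the product, and
  on it \<open>d(\<phi> \<oplus> \<psi>) = d\<phi> + d\<psi>\<close> restricts to \<open>d\<phi>\<close> and \<open>d\<psi>\<close> (\<open>norm2_diff_direct_sum\<close>). A function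
  \<open>u(p) + v(q)\<close> has gradient \<open>(grad u, grad v)\<close> for the product metric. Applying \<open>d(\<phi> \<oplus> \<psi>)\<close> to the
  gradient of the energy density therefore gives
  \<open>d\<phi>(grad |d\<phi>|\<^sup>2) + d\<psi>(grad |d\<psi>|\<^sup>2) = 0\<close>.

  Everything is computed in charts. The tangent space at \<open>p\<close> is identified with the model space by
  the coordinates in a chart, which turns the metric into a positive definite bilinear form. The
  energy density is then the trace of a quadratic form (\<open>norm2_diff_eq\<close>), and the gradient is
  characterised by the Riesz property (\<open>gradient_in_chart\<close>). These descriptions hold in every chart
  around the point, so on the product one may use a product chart, although norm, differential and
  gradient are defined with an arbitrarily chosen orthonormal basis and chart.

  The one analytic ingredient is that the energy density of a \<open>C\<^sup>2\<close> map is differentiable, as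
  otherwise its Frechet derivative would be an unspecified value. It follows from a local
  orthonormal frame with differentiable coefficients, which Gram-Schmidt orthonormalisation of the
  coordinate frame provides (\<open>differentiable_orthonormal_frame\<close>).\<close>

section \<open>Positive definite forms and orthonormal frames\<close>

lemma differentiable_transform_open:
  assumes "f differentiable (at z)" "open S" "z \<in> S" "\<And>y. y \<in> S \<Longrightarrow> f y = g y"
  shows "g differentiable (at z)"
  using assms has_derivative_transform_within_open unfolding differentiable_def by blast

text \<open>A symmetric positive definite bilinear form. Linearity in the first argument follows by symmetry.\<close>

definition pos_def_form :: "('e::real_vector \<Rightarrow> 'e \<Rightarrow> real) \<Rightarrow> bool" where
  "pos_def_form b \<longleftrightarrow>
     (\<forall>x. linear (b x)) \<and> (\<forall>x y. b x y = b y x) \<and> (\<forall>x. x \<noteq> 0 \<longrightarrow> b x x > 0)"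

text \<open>A finite basis that is orthonormal for the form \<open>b\<close>; if \<open>b\<close> is bilinear, linear
  independence follows from orthonormality.\<close>

definition form_basis :: "('e::real_vector \<Rightarrow> 'e \<Rightarrow> real) \<Rightarrow> 'e set \<Rightarrow> bool" where
  "form_basis b B \<longleftrightarrow>
     finite B \<and> (\<forall>u\<in>B. \<forall>v\<in>B. b u v = (if u = v then 1 else 0)) \<and> span B = UNIV"

lemma pos_def_form_linear:
  assumes "pos_def_form b"
  shows "linear (b x)" "linear (\<lambda>x. b x y)"
proof -
  have "(\<lambda>x. b x y) = b y" using assms unfolding pos_def_form_def by blast
  then show "linear (b x)" "linear (\<lambda>x. b x y)" using assms unfolding pos_def_form_def by simp_all
qed

lemma pos_def_form_eqI:
  assumes "pos_def_form b" "\<And>w. b x w = b y w"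
  shows "x = y"
proof (rule ccontr)
  assume "x \<noteq> y"
  then have "b (x - y) (x - y) > 0" using assms(1) by (auto simp: pos_def_form_def)
  moreover have "b (x - y) (x - y) = b x (x - y) - b y (x - y)"
    using linear_diff[OF pos_def_form_linear(2)[OF assms(1)]] .
  ultimately show False using assms(2) by simp
qed

lemma form_basis_expansion:
  assumes b: "pos_def_form b" and B: "form_basis b B"
  shows "x = (\<Sum>u\<in>B. b x u *\<^sub>R u)"
proof -
  have fin: "finite B" and sp: "span B = UNIV"
    and on: "\<And>u v. u \<in> B \<Longrightarrow> v \<in> B \<Longrightarrow> b u v = (if u = v then 1 else 0)"
    using B by (auto simp: form_basis_def)
  obtain a where a: "x = (\<Sum>u\<in>B. a u *\<^sub>R u)"
    using sp span_finite[OF fin] by auto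
  have "b x v = a v" if "v \<in> B" for v
  proof -
    have "b x v = (\<Sum>u\<in>B. a u * b u v)"
      by (simp add: a linear_sum[OF pos_def_form_linear(2)[OF b]]
          linear_scale[OF pos_def_form_linear(2)[OF b]])
    also have "\<dots> = (\<Sum>u\<in>B. if u = v then a v else 0)"
      using on that by (intro sum.cong) auto
    finally show ?thesis using fin that by simp
  qed
  then show ?thesis using a by simp
qed

text \<open>Expanding the vectors of either basis in the other one gives
  \<open>\<Sum>\<^sub>u |L u|\<^sup>2 = \<Sum>\<^sub>u\<^sub>v b(u, v) (L u \<bullet> L v) = \<Sum>\<^sub>v |L v|\<^sup>2\<close>.\<close>

lemma form_basis_trace_independent:
  fixes L :: "'e::real_vector \<Rightarrow> 'v::real_inner"
  assumes b: "pos_def_form b" and B: "form_basis b B" and C: "form_basis b C" and L: "linear L"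
  shows "(\<Sum>u\<in>B. L u \<bullet> L u) = (\<Sum>u\<in>C. L u \<bullet> L u)"
proof -
  have ex: "L x = (\<Sum>v\<in>D. b x v *\<^sub>R L v)" if "form_basis b D" for D x
    by (subst form_basis_expansion[OF b that, of x]) (simp add: linear_sum[OF L] linear_scale[OF L])
  have sym: "b u v = b v u" for u v using b by (auto simp: pos_def_form_def)
  have "(\<Sum>u\<in>B. L u \<bullet> L u) = (\<Sum>u\<in>B. \<Sum>v\<in>C. b u v * (L u \<bullet> L v))"
    by (rule sum.cong[OF refl]) (subst (2) ex[OF C], simp add: inner_sum_right)
  also have "\<dots> = (\<Sum>v\<in>C. \<Sum>u\<in>B. b v u * (L u \<bullet> L v))"
    by (subst sum.swap) (simp add: sym)
  also have "\<dots> = (\<Sum>v\<in>C. L v \<bullet> L v)"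
    by (rule sum.cong[OF refl]) (subst (3) ex[OF B], simp add: inner_sum_left)
  finally show ?thesis .
qed

lemma form_riesz:
  assumes b: "pos_def_form b" and B: "form_basis b B" and l: "linear l"
  shows "\<exists>!x. \<forall>w. b x w = l w"
proof -
  have "b (\<Sum>u\<in>B. l u *\<^sub>R u) w = l w" for w
  proof -
    have sym: "b u v = b v u" for u v using b by (auto simp: pos_def_form_def)
    have "b (\<Sum>u\<in>B. l u *\<^sub>R u) w = (\<Sum>u\<in>B. l u * b w u)"
      by (simp add: linear_sum[OF pos_def_form_linear(2)[OF b]]
          linear_scale[OF pos_def_form_linear(2)[OF b]] sym[of w])
    also have "\<dots> = l (\<Sum>u\<in>B. b w u *\<^sub>R u)"
      by (simp add: linear_sum[OF l] linear_scale[OF l] mult.commute)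
    finally show ?thesis
      using form_basis_expansion[OF b B, of w] by simp
  qed
  then show ?thesis by (intro ex_ex1I) (blast, rule pos_def_form_eqI[OF b], simp)
qed

lemma form_basis_Times:
  fixes b :: "'e::real_vector \<Rightarrow> 'e \<Rightarrow> real" and k :: "'f::real_vector \<Rightarrow> 'f \<Rightarrow> real"
  assumes b: "pos_def_form b" and B: "form_basis b B" and k: "pos_def_form k" and K: "form_basis k K"
  shows "form_basis (\<lambda>x y. b (fst x) (fst y) + k (snd x) (snd y))
           ((\<lambda>x. (x, 0)) ` B \<union> (\<lambda>y. (0, y)) ` K)"
proof -
  have z: "b 0 x = 0" "b x 0 = 0" "k 0 y = 0" "k y 0 = 0" for x y
    using linear_0[OF pos_def_form_linear(1)[OF b]] linear_0[OF pos_def_form_linear(2)[OF b]]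
      linear_0[OF pos_def_form_linear(1)[OF k]] linear_0[OF pos_def_form_linear(2)[OF k]] by auto
  have n0: "0 \<notin> B" "0 \<notin> K" using B K z by (fastforce simp: form_basis_def)+
  let ?U = "(\<lambda>x. (x, 0)) ` B \<union> (\<lambda>y. (0, y)) ` K"
  have "w \<in> span ?U" for w
  proof -
    obtain x y where w: "w = (x, y)" by fastforce
    have lin: "linear (\<lambda>x::'e. (x, 0::'f))" "linear (\<lambda>y::'f. (0::'e, y))"
      by (auto intro!: linearI)
    have "span ((\<lambda>x. (x, 0::'f)) ` B) = (\<lambda>x. (x, 0)) ` span B"
      "span ((\<lambda>y. (0::'e, y)) ` K) = (\<lambda>y. (0, y)) ` span K"
      by (rule span_linear_image[OF lin(1)], rule span_linear_image[OF lin(2)])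
    moreover have "span B = UNIV" "span K = UNIV" using B K by (auto simp: form_basis_def)
    ultimately have "(x, 0) \<in> span ((\<lambda>x. (x, 0::'f)) ` B)" "(0, y) \<in> span ((\<lambda>y. (0::'e, y)) ` K)"
      by simp_all
    then have "(x, 0) + (0, y) \<in> span ?U"
      by (intro span_add) (erule subsetD[OF span_mono, rotated], blast)+
    then show ?thesis by (simp add: w)
  qed
  moreover have "finite ?U" using B K by (auto simp: form_basis_def)
  moreover have "b (fst u) (fst v) + k (snd u) (snd v) = (if u = v then 1 else 0)"
    if uv: "u \<in> ?U" "v \<in> ?U" for u v
  proof -
    have "\<And>u v. u \<in> B \<Longrightarrow> v \<in> B \<Longrightarrow> b u v = (if u = v then 1 else 0)"
      "\<And>u v. u \<in> K \<Longrightarrow> v \<in> K \<Longrightarrow> k u v = (if u = v then 1 else 0)"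
      using B K by (auto simp: form_basis_def)
    then show ?thesis using uv n0 by (elim UnE imageE) (simp_all add: z, metis+)
  qed
  ultimately show ?thesis unfolding form_basis_def by blast
qed

lemma pos_def_form_Times:
  assumes b: "pos_def_form b" and k: "pos_def_form k"
  shows "pos_def_form (\<lambda>x y. b (fst x) (fst y) + k (snd x) (snd y))"
proof -
  have "linear (\<lambda>y. b (fst x) (fst y) + k (snd x) (snd y))" for x
    using linear_compose[OF linear_fst pos_def_form_linear(1)[OF b, of "fst x"]]
      linear_compose[OF linear_snd pos_def_form_linear(1)[OF k, of "snd x"]]
    by (intro linear_compose_add) (simp_all add: o_def)
  moreover have "b 0 0 = 0" "k 0 0 = 0"
    using linear_0[OF pos_def_form_linear(1)[OF b]] linear_0[OF pos_def_form_linear(1)[OF k]] by auto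
  moreover have "b (fst x) (fst x) + k (snd x) (snd x) > 0" if "x \<noteq> 0" for x
    using b k that \<open>b 0 0 = 0\<close> \<open>k 0 0 = 0\<close> unfolding pos_def_form_def
    by (metis add_pos_pos add.right_neutral add.left_neutral prod.collapse zero_prod_def)
  ultimately show ?thesis using b k unfolding pos_def_form_def by simp
qed

lemma differentiable_form:
  fixes b :: "'e::euclidean_space \<Rightarrow> 'e \<Rightarrow> 'e \<Rightarrow> real"
  assumes S: "open S" "z \<in> S" and b: "\<And>z. z \<in> S \<Longrightarrow> pos_def_form (b z)"
    and d: "\<And>u v. (\<lambda>z. b z u v) differentiable (at z)"
    and X: "X differentiable (at z)" and Y: "Y differentiable (at z)"
  shows "(\<lambda>z. b z (X z) (Y z)) differentiable (at z)"
proof -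
  have eq: "b z (X z) (Y z) = (\<Sum>i\<in>Basis. \<Sum>j\<in>Basis. (X z \<bullet> i) * ((Y z \<bullet> j) * b z i j))"
    if "z \<in> S" for z
  proof -
    note l = pos_def_form_linear[OF b[OF that]]
    have "b z (X z) (Y z) = (\<Sum>i\<in>Basis. (X z \<bullet> i) * b z i (Y z))"
      by (subst (1) euclidean_representation[of "X z", symmetric])
        (simp only: linear_sum[OF l(2)] linear_scale[OF l(2)] real_scaleR_def)
    moreover have "b z i (Y z) = (\<Sum>j\<in>Basis. (Y z \<bullet> j) * b z i j)" for i
      by (subst (1) euclidean_representation[of "Y z", symmetric])
        (simp only: linear_sum[OF l(1)] linear_scale[OF l(1)] real_scaleR_def)
    ultimately have "b z (X z) (Y z) = (\<Sum>i\<in>Basis. (X z \<bullet> i) * (\<Sum>j\<in>Basis. (Y z \<bullet> j) * b z i j))"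
      by (simp only:)
    then show ?thesis by (simp add: sum_distrib_left)
  qed
  have "(\<lambda>z. \<Sum>i\<in>Basis. \<Sum>j\<in>Basis. (X z \<bullet> i) * ((Y z \<bullet> j) * b z i j)) differentiable (at z)"
    by (intro differentiable_sum differentiable_mult differentiable_inner d X Y ballI) auto
  then show ?thesis
    by (rule differentiable_transform_open[OF _ S]) (simp add: eq)
qed

text \<open>Gram-Schmidt orthonormalisation of fixed vectors \<open>A\<close> with respect to a form \<open>b z\<close> that depends
  differentiably on \<open>z\<close>. The statement covers every finite independent set, not only a basis, so
  that the induction on \<open>A\<close> goes through.\<close>

lemma differentiable_orthonormal_frame:
  fixes b :: "'e::euclidean_space \<Rightarrow> 'e \<Rightarrow> 'e \<Rightarrow> real"
  assumes S: "open S" and b: "\<And>z. z \<in> S \<Longrightarrow> pos_def_form (b z)"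
    and d: "\<And>u v z. z \<in> S \<Longrightarrow> (\<lambda>z. b z u v) differentiable (at z)"
    and A: "finite A" "independent A"
  shows "\<exists>E. \<forall>z\<in>S. (\<forall>a\<in>A. E a differentiable (at z)) \<and>
     (\<forall>u\<in>A. \<forall>v\<in>A. b z (E u z) (E v z) = (if u = v then 1 else 0)) \<and>
     span ((\<lambda>a. E a z) ` A) = span A"
  using A
proof (induction A rule: finite_induct)
  case empty
  show ?case by simp
next
  case (insert a A)
  have aA: "a \<notin> span A" and "independent A"
    using insert.prems insert.hyps by (simp_all add: independent_insert)
  then obtain E where E: "\<And>z u. z \<in> S \<Longrightarrow> u \<in> A \<Longrightarrow> E u differentiable (at z)"
      "\<And>z u v. z \<in> S \<Longrightarrow> u \<in> A \<Longrightarrow> v \<in> A \<Longrightarrow> b z (E u z) (E v z) = (if u = v then 1 else 0)"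
      "\<And>z. z \<in> S \<Longrightarrow> span ((\<lambda>a. E a z) ` A) = span A"
    using insert.IH by blast
  \<comment> \<open>\<open>P z\<close> is the \<open>b z\<close>-orthogonal projection of \<open>a\<close> to the span of \<open>A\<close>, for \<open>z\<close> in \<open>S\<close>.\<close>
  define P where "P z = (\<Sum>u\<in>A. b z a (E u z) *\<^sub>R E u z)" for z
  define X where "X z = a - P z" for z
  define Y where "Y z = (1 / sqrt (b z (X z) (X z))) *\<^sub>R X z" for z
  define F where "F = E(a := Y)"
  have F: "F a = Y" "\<And>u. u \<in> A \<Longrightarrow> F u = E u" using insert.hyps by (auto simp: F_def)
  show ?case
  proof (intro exI[of _ F] ballI)
    fix z assume z: "z \<in> S"
    note l = pos_def_form_linear[OF b[OF z]]
    have sym: "b z u v = b z v u" for u v using b[OF z] by (auto simp: pos_def_form_def)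
    have PA: "P z \<in> span A"
      unfolding P_def E(3)[OF z, symmetric] by (intro span_sum span_scale span_base) auto
    have "X z \<noteq> 0" using PA aA by (auto simp: X_def)
    then have pos: "b z (X z) (X z) > 0" using b[OF z] by (auto simp: pos_def_form_def)
    have dX: "X differentiable (at z)"
      unfolding X_def[abs_def] P_def
      by (intro differentiable_diff differentiable_sum differentiable_scaleR
          differentiable_form[OF S z b d] E z differentiable_const insert.hyps ballI)
    have "(\<lambda>z. b z (X z) (X z)) differentiable (at z)"
      by (intro differentiable_form[OF S z b d] z dX)
    then have "(\<lambda>z. sqrt (b z (X z) (X z))) differentiable (at z)"
      using has_derivative_real_sqrt[where g = "\<lambda>z. b z (X z) (X z)", OF pos]
      unfolding differentiable_def by blast
    then have dY: "Y differentiable (at z)"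
      unfolding Y_def[abs_def] using pos dX
      by (intro differentiable_scaleR differentiable_divide) auto
    have "b z (X z) (E v z) = 0" if "v \<in> A" for v
    proof -
      have "b z (P z) (E v z) = (\<Sum>u\<in>A. b z a (E u z) * b z (E u z) (E v z))"
        by (simp add: P_def linear_sum[OF l(2)] linear_scale[OF l(2)])
      also have "\<dots> = (\<Sum>u\<in>A. if u = v then b z a (E v z) else 0)"
        using E(2)[OF z _ that] by (intro sum.cong) auto
      finally show ?thesis using insert.hyps that by (simp add: X_def linear_diff[OF l(2)])
    qed
    then have YE: "b z (Y z) (E v z) = 0" if "v \<in> A" for v
      using that by (simp add: Y_def linear_scale[OF l(2)])
    have YY: "b z (Y z) (Y z) = 1"
      using pos by (simp add: Y_def linear_scale[OF l(2)] linear_scale[OF l(1)])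
    have "X z = sqrt (b z (X z) (X z)) *\<^sub>R Y z" using pos by (simp add: Y_def)
    then have aY: "a = P z + sqrt (b z (X z) (X z)) *\<^sub>R Y z" by (simp add: X_def)
    have im: "(\<lambda>u. F u z) ` insert a A = insert (Y z) ((\<lambda>u. E u z) ` A)"
      using F by auto
    have "span (insert (Y z) ((\<lambda>u. E u z) ` A)) = span (insert a A)"
    proof (rule antisym; rule span_minimal; (rule subspace_span)?; rule insert_subsetI)
      have "P z \<in> span (insert a A)" using PA span_mono[of A "insert a A"] by blast
      then show "Y z \<in> span (insert a A)"
        unfolding Y_def X_def by (simp add: span_scale span_diff span_base)
      show "(\<lambda>u. E u z) ` A \<subseteq> span (insert a A)"
        using E(3)[OF z] span_superset[of "(\<lambda>u. E u z) ` A"] span_mono[of A "insert a A"] by blast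
      have "span A \<subseteq> span (insert (Y z) ((\<lambda>u. E u z) ` A))"
        unfolding E(3)[OF z, symmetric] by (intro span_mono) auto
      then show "A \<subseteq> span (insert (Y z) ((\<lambda>u. E u z) ` A))"
        using span_superset[of A] by blast
      have "P z + sqrt (b z (X z) (X z)) *\<^sub>R Y z \<in> span (insert (Y z) ((\<lambda>u. E u z) ` A))"
        using PA \<open>span A \<subseteq> _\<close> by (blast intro: span_add span_scale span_base)
      then show "a \<in> span (insert (Y z) ((\<lambda>u. E u z) ` A))" using aY by simp
    qed
    moreover have "b z (F u z) (F v z) = (if u = v then 1 else 0)"
      if "u \<in> insert a A" "v \<in> insert a A" for u v
    proof (cases "u = a"; cases "v = a")
      assume "u = a" "v = a" then show ?thesis using F(1) YY by simp
    next
      assume "u = a" "v \<noteq> a" then show ?thesis using that F YE[of v] by simp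
    next
      assume "u \<noteq> a" "v = a"
      then show ?thesis using that F YE[of u] sym[of "E u z" "Y z"] by simp
    next
      assume "u \<noteq> a" "v \<noteq> a" then show ?thesis using that F(2) E(2)[OF z, of u v] by simp
    qed
    moreover have "F u differentiable (at z)" if "u \<in> insert a A" for u
      using that F dY E(1)[OF z, of u] by (cases "u = a") simp_all
    ultimately show "(\<forall>u\<in>insert a A. F u differentiable (at z)) \<and>
       (\<forall>u\<in>insert a A. \<forall>v\<in>insert a A. b z (F u z) (F v z) = (if u = v then 1 else 0)) \<and>
       span ((\<lambda>u. F u z) ` insert a A) = span (insert a A)"
      unfolding im by blast
  qed
qed

lemma differentiable_form_basis:
  fixes b :: "'e::euclidean_space \<Rightarrow> 'e \<Rightarrow> 'e \<Rightarrow> real"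
  assumes S: "open S" and b: "\<And>z. z \<in> S \<Longrightarrow> pos_def_form (b z)"
    and d: "\<And>u v z. z \<in> S \<Longrightarrow> (\<lambda>z. b z u v) differentiable (at z)"
  obtains E :: "'e \<Rightarrow> 'e \<Rightarrow> 'e" where "\<And>z a. z \<in> S \<Longrightarrow> a \<in> Basis \<Longrightarrow> E a differentiable (at z)"
    and "\<And>z. z \<in> S \<Longrightarrow> inj_on (\<lambda>a. E a z) Basis"
    and "\<And>z. z \<in> S \<Longrightarrow> form_basis (b z) ((\<lambda>a. E a z) ` Basis)"
proof -
  have "\<exists>E :: 'e \<Rightarrow> 'e \<Rightarrow> 'e. \<forall>z\<in>S. (\<forall>a\<in>Basis. E a differentiable (at z)) \<and>
     (\<forall>u\<in>Basis. \<forall>v\<in>Basis. b z (E u z) (E v z) = (if u = v then 1 else 0)) \<and>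
     span ((\<lambda>a. E a z) ` Basis) = span (Basis :: 'e set)"
    by (rule differentiable_orthonormal_frame[OF S b d finite_Basis independent_Basis])
  then obtain E :: "'e \<Rightarrow> 'e \<Rightarrow> 'e" where "\<forall>z\<in>S. (\<forall>a\<in>Basis. E a differentiable (at z)) \<and>
     (\<forall>u\<in>Basis. \<forall>v\<in>Basis. b z (E u z) (E v z) = (if u = v then 1 else 0)) \<and>
     span ((\<lambda>a. E a z) ` Basis) = span (Basis :: 'e set)" ..
  then have E: "\<And>z u. z \<in> S \<Longrightarrow> u \<in> Basis \<Longrightarrow> E u differentiable (at z)"
      "\<And>z u v. z \<in> S \<Longrightarrow> u \<in> Basis \<Longrightarrow> v \<in> Basis \<Longrightarrow>
         b z (E u z) (E v z) = (if u = v then 1 else 0)"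
      "\<And>z. z \<in> S \<Longrightarrow> span ((\<lambda>a. E a z) ` Basis) = span Basis"
    by auto
  have inj: "inj_on (\<lambda>a. E a z) Basis" if "z \<in> S" for z
    using E(2)[OF that] by (intro inj_onI) (metis zero_neq_one)
  show ?thesis
  proof (rule that[OF E(1) inj])
    fix z assume z: "z \<in> S"
    show "form_basis (b z) ((\<lambda>a. E a z) ` Basis)"
      unfolding form_basis_def using E(2,3)[OF z] by (auto simp: inj_on_eq_iff[OF inj[OF z]])
  qed
qed

lemma ex_form_basis:
  fixes b :: "'e::euclidean_space \<Rightarrow> 'e \<Rightarrow> real"
  assumes "pos_def_form b"
  shows "\<exists>B. form_basis b B"
proof -
  obtain E :: "'e \<Rightarrow> 'e \<Rightarrow> 'e" where "\<And>z. z \<in> UNIV \<Longrightarrow> form_basis b ((\<lambda>a. E a z) ` Basis)"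
    by (rule differentiable_form_basis[of UNIV "\<lambda>_. b"]) (simp_all add: assms, blast)
  then show ?thesis by blast
qed

section \<open>Tangent spaces, energy density and gradient in a chart\<close>

text \<open>The part of the manifold axioms that coordinate computations use: charts are injective with open
  overlaps, and transition maps are differentiable. It passes to products at once.\<close>

definition differentiable_atlas :: "('a, 'e::euclidean_space) mfd \<Rightarrow> bool" where
  "differentiable_atlas M \<longleftrightarrow>
     (\<forall>c\<in>atlas M. inj_on (snd c) (fst c)) \<and>
     (\<forall>c\<in>atlas M. \<forall>c'\<in>atlas M. open (snd c ` (fst c \<inter> fst c')) \<and>
        (\<forall>x\<in>snd c ` (fst c \<inter> fst c'). transition c c' differentiable (at x)))"

lemma chart_inv_image: "inj_on (snd c) (fst c) \<Longrightarrow> p \<in> fst c \<Longrightarrow> chart_inv c (snd c p) = p"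
  by (simp add: chart_inv_def)

lemma smooth_manifold_differentiable_atlas:
  assumes M: "smooth_manifold M"
  shows "differentiable_atlas M"
  unfolding differentiable_atlas_def
proof (intro conjI ballI)
  fix c assume c: "c \<in> atlas M"
  then have o: "openin (mtop M) (fst c)" "open (snd c ` fst c)"
    and h: "homeomorphic_map (subtopology (mtop M) (fst c)) (top_of_set (snd c ` fst c)) (snd c)"
    using M by (auto simp: smooth_manifold_def)
  have "topspace (subtopology (mtop M) (fst c)) = fst c"
    using o(1) by (meson openin_subset topspace_subtopology_subset)
  then show "inj_on (snd c) (fst c)" using homeomorphic_imp_injective_map[OF h] by simp
  fix c' assume c': "c' \<in> atlas M"
  then have "openin (mtop M) (fst c')" using M by (auto simp: smooth_manifold_def)
  then have "openin (subtopology (mtop M) (fst c)) (fst c \<inter> fst c')"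
    by (simp add: inf_commute openin_subtopology_Int)
  then have "openin (top_of_set (snd c ` fst c)) (snd c ` (fst c \<inter> fst c'))"
    using homeomorphic_imp_open_map[OF h] by (simp add: open_map_def)
  then show "open (snd c ` (fst c \<inter> fst c'))" using o(2) openin_open_eq by blast
  have "smooth_on (snd c ` (fst c \<inter> fst c')) (transition c c')"
    using M c c' by (simp add: smooth_manifold_def)
  then have "Ck_on (Suc 0) (snd c ` (fst c \<inter> fst c')) (transition c c')"
    unfolding smooth_on_def by blast
  then show "transition c c' differentiable (at x)" if "x \<in> snd c ` (fst c \<inter> fst c')" for x
    using that unfolding Ck_on.simps by blast
qed

lemma charts_atD: "c \<in> charts_at M p \<Longrightarrow> c \<in> atlas M" "c \<in> charts_at M p \<Longrightarrow> p \<in> fst c"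
  by (auto simp: charts_at_def)

lemma differentiable_atlasD:
  assumes "differentiable_atlas M" "c \<in> charts_at M p" "c' \<in> charts_at M p"
  shows "inj_on (snd c) (fst c)" "open (snd c ` (fst c \<inter> fst c'))"
    "snd c p \<in> snd c ` (fst c \<inter> fst c')" "transition c c' differentiable (at (snd c p))"
  using assms by (auto simp: differentiable_atlas_def charts_at_def)

text \<open>The chain rule for \<open>f \<circ> chart_inv c = (f \<circ> chart_inv c') \<circ> transition c c'\<close>, which holds near the
  image of \<open>p\<close>.\<close>

lemma change_of_chart:
  assumes M: "differentiable_atlas M" and c: "c \<in> charts_at M p" and c': "c' \<in> charts_at M p"
    and f: "(f \<circ> chart_inv c') differentiable (at (snd c' p))"
  shows "(f \<circ> chart_inv c) differentiable (at (snd c p))" (is ?diff)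
    and "frechet_derivative (f \<circ> chart_inv c) (at (snd c p)) x =
      frechet_derivative (f \<circ> chart_inv c') (at (snd c' p))
        (frechet_derivative (transition c c') (at (snd c p)) x)" (is ?eq)
proof -
  note D = differentiable_atlasD[OF M c c'] and inj' = differentiable_atlasD(1)[OF M c' c]
  have T: "transition c c' (snd c p) = snd c' p"
    using charts_atD(2)[OF c] by (simp add: transition_def chart_inv_image[OF D(1)])
  have f': "(f \<circ> chart_inv c') differentiable (at (transition c c' (snd c p)))" using f T by simp
  have eq: "((f \<circ> chart_inv c') \<circ> transition c c') y = (f \<circ> chart_inv c) y"
    if "y \<in> snd c ` (fst c \<inter> fst c')" for y
    using that by (auto simp: transition_def chart_inv_image[OF D(1)] chart_inv_image[OF inj'])
  have d: "((f \<circ> chart_inv c') \<circ> transition c c') differentiable (at (snd c p))"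
    by (rule differentiable_chain_at[OF D(4) f'])
  show ?diff by (rule differentiable_transform_open[OF d D(2,3) eq])
  have "frechet_derivative (f \<circ> chart_inv c) (at (snd c p)) x =
      frechet_derivative ((f \<circ> chart_inv c') \<circ> transition c c') (at (snd c p)) x"
    by (rule fun_cong, rule frechet_derivative_transform_within_open[OF d D(2,3) eq, symmetric])
  also have "\<dots> = frechet_derivative (f \<circ> chart_inv c') (at (snd c' p))
      (frechet_derivative (transition c c') (at (snd c p)) x)"
    unfolding frechet_derivative_compose[OF D(4) f'] T by (rule comp_apply)
  finally show ?eq .
qed

lemma frechet_derivative_transition_self:
  assumes M: "differentiable_atlas M" and c: "c \<in> charts_at M p"
  shows "frechet_derivative (transition c c) (at (snd c p)) x = x"
proof -
  note D = differentiable_atlasD[OF M c c]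
  have "frechet_derivative (transition c c) (at (snd c p)) = frechet_derivative id (at (snd c p))"
    by (rule frechet_derivative_transform_within_open[OF D(4,2,3)])
      (auto simp: transition_def chart_inv_image[OF D(1)])
  then show ?thesis by simp
qed

lemma frechet_derivative_transition_trans:
  assumes M: "differentiable_atlas M"
    and c: "c \<in> charts_at M p" "c' \<in> charts_at M p" "c'' \<in> charts_at M p"
  shows "frechet_derivative (transition c c'') (at (snd c p)) x =
     frechet_derivative (transition c' c'') (at (snd c' p))
       (frechet_derivative (transition c c') (at (snd c p)) x)"
  using change_of_chart(2)[OF M c(1,2), of "snd c''"] differentiable_atlasD(4)[OF M c(2,3)]
  by (simp add: transition_def)

lemma coord_tvec_in_tangent_space:
  assumes "differentiable_atlas M" "c \<in> charts_at M p"
  shows "coord_tvec M c p x \<in> tangent_space M p"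
  unfolding tangent_space_def mem_Collect_eq
proof (intro conjI ballI)
  fix c' c'' assume "c' \<in> charts_at M p" "c'' \<in> charts_at M p"
  with frechet_derivative_transition_trans[OF assms this, of x]
  show "coord_tvec M c p x c'' =
      frechet_derivative (transition c' c'') (at (snd c' p)) (coord_tvec M c p x c')"
    by (simp only: coord_tvec_def if_True)
qed (simp add: coord_tvec_def)

lemma coord_tvec_self:
  assumes "differentiable_atlas M" "c \<in> charts_at M p"
  shows "coord_tvec M c p x c = x"
  using frechet_derivative_transition_self[OF assms] assms(2) by (simp add: coord_tvec_def)

lemma coord_tvec_eq:
  assumes "v \<in> tangent_space M p" "c \<in> charts_at M p"
  shows "coord_tvec M c p (v c) = v"
proof
  fix c'
  have "v c' = frechet_derivative (transition c c') (at (snd c p)) (v c)" if "c' \<in> charts_at M p"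
    using assms that unfolding tangent_space_def by blast
  moreover have "v c' = 0" if "c' \<notin> charts_at M p"
    using assms that unfolding tangent_space_def by blast
  ultimately show "coord_tvec M c p (v c) c' = v c'" unfolding coord_tvec_def by presburger
qed

lemma tangent_space_eqI:
  assumes "u \<in> tangent_space M p" "v \<in> tangent_space M p" "c \<in> charts_at M p" "u c = v c"
  shows "u = v"
  using coord_tvec_eq[OF assms(1,3), unfolded assms(4)] coord_tvec_eq[OF assms(2,3)] by (rule trans[OF sym])

lemma linear_coord_tvec:
  assumes "differentiable_atlas M" "c \<in> charts_at M p"
  shows "linear (\<lambda>x. coord_tvec M c p x c')"
proof (cases "c' \<in> charts_at M p")
  case True
  then show ?thesis
    using linear_frechet_derivative[OF differentiable_atlasD(4)[OF assms True]]
    by (simp add: coord_tvec_def)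
qed (simp add: coord_tvec_def linear_zero)

text \<open>The differential can be computed in every chart around \<open>p\<close>, not only in the one chosen by its
  definition.\<close>

lemma vdiff_eq:
  assumes M: "differentiable_atlas M" and c: "c \<in> charts_at M p" and v: "v \<in> tangent_space M p"
    and f: "(f \<circ> chart_inv c) differentiable (at (snd c p))"
  shows "vdiff M f p v = frechet_derivative (f \<circ> chart_inv c) (at (snd c p)) (v c)"
proof -
  define c' where "c' = (SOME c. c \<in> charts_at M p)"
  have c': "c' \<in> charts_at M p" unfolding c'_def using c by (rule someI)
  have "vdiff M f p v = frechet_derivative (f \<circ> chart_inv c') (at (snd c' p)) (v c')"
    by (simp add: vdiff_def c'_def Let_def)
  also have "\<dots> = frechet_derivative (f \<circ> chart_inv c) (at (snd c p))
      (frechet_derivative (transition c' c) (at (snd c' p)) (v c'))"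
    by (rule change_of_chart(2)[OF M c' c f])
  also have "frechet_derivative (transition c' c) (at (snd c' p)) (v c') = v c"
  proof -
    have "\<forall>c\<in>charts_at M p. \<forall>c'\<in>charts_at M p.
        v c' = frechet_derivative (transition c c') (at (snd c p)) (v c)"
      using v unfolding tangent_space_def by blast
    from bspec[OF bspec[OF this c'] c] show ?thesis by (rule sym)
  qed
  finally show ?thesis .
qed

text \<open>The metric at \<open>p\<close> in the coordinates of the chart \<open>c\<close>, as a form on the model space.\<close>

definition metric_in_chart ::
  "('a, 'e::euclidean_space) mfd \<Rightarrow> ('a, 'e) metric \<Rightarrow> ('a, 'e) chart \<Rightarrow> 'a \<Rightarrow> 'e \<Rightarrow> 'e \<Rightarrow> real" where
  "metric_in_chart M g c p x y = g p (coord_tvec M c p x) (coord_tvec M c p y)"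

lemma metric_in_chart_eq:
  assumes "u \<in> tangent_space M p" "v \<in> tangent_space M p" "c \<in> charts_at M p"
  shows "g p u v = metric_in_chart M g c p (u c) (v c)"
  using assms by (simp add: metric_in_chart_def coord_tvec_eq)

lemma pos_def_metric_in_chart:
  assumes M: "differentiable_atlas M" and c: "c \<in> charts_at M p"
    and g: "inner_product_on (tangent_space M p) (g p)"
  shows "pos_def_form (metric_in_chart M g c p)"
proof -
  let ?b = "metric_in_chart M g c p"
  note t = coord_tvec_in_tangent_space[OF M c] and l = linear_coord_tvec[OF M c]
  have sym: "?b x y = ?b y x" for x y
    using g t by (auto simp: inner_product_on_def metric_in_chart_def)
  have "coord_tvec M c p (a *\<^sub>R x + y) = (\<lambda>c'. a *\<^sub>R coord_tvec M c p x c' + coord_tvec M c p y c')"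
    for a x y using linear_add[OF l] linear_scale[OF l] by (intro ext) simp
  then have lin: "?b (a *\<^sub>R x + y) w = a * ?b x w + ?b y w" for a x y w
    using g t unfolding inner_product_on_def metric_in_chart_def by simp
  have 0: "?b 0 w = 0" for w using lin[of 1 0 0 w] by simp
  have lin2: "?b w (a *\<^sub>R x + y) = a * ?b w x + ?b w y" for a x y w
    by (simp only: sym[of w] lin)
  have "linear (?b w)" for w
    using lin2[of w 1] lin2[of w _ _ 0] 0[of w] sym[of w 0] by (intro linearI) simp_all
  moreover have "?b x x > 0" if "x \<noteq> 0" for x
  proof -
    have "coord_tvec M c p x \<noteq> (\<lambda>_. 0)" using coord_tvec_self[OF M c, of x] that by auto
    then show ?thesis using g t unfolding inner_product_on_def metric_in_chart_def by blast
  qed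
  ultimately show ?thesis using sym unfolding pos_def_form_def by blast
qed

lemma orthonormal_basis_in_chart:
  assumes M: "differentiable_atlas M" and c: "c \<in> charts_at M p" and B: "orthonormal_basis M g p B"
  shows "form_basis (metric_in_chart M g c p) ((\<lambda>v. v c) ` B)" and "inj_on (\<lambda>v. v c) B"
proof -
  have BT: "B \<subseteq> tangent_space M p" and fin: "finite B"
    and on: "\<And>u v. u \<in> B \<Longrightarrow> v \<in> B \<Longrightarrow> g p u v = (if u = v then 1 else 0)"
    using B by (auto simp: orthonormal_basis_def)
  show inj: "inj_on (\<lambda>v. v c) B"
    using BT tangent_space_eqI[OF _ _ c] by (intro inj_onI) blast
  have "metric_in_chart M g c p (u c) (v c) = (if u c = v c then 1 else 0)"
    if "u \<in> B" "v \<in> B" for u v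
    using on[OF that] inj_on_eq_iff[OF inj that]
      metric_in_chart_eq[OF subsetD[OF BT that(1)] subsetD[OF BT that(2)] c, of g] by simp
  moreover have "x \<in> span ((\<lambda>v. v c) ` B)" for x
  proof -
    obtain a where "coord_tvec M c p x = (\<lambda>c'. \<Sum>u\<in>B. a u *\<^sub>R u c')"
      using B coord_tvec_in_tangent_space[OF M c, of x] unfolding orthonormal_basis_def by blast
    then have "x = (\<Sum>u\<in>B. a u *\<^sub>R u c)" using coord_tvec_self[OF M c, of x] by simp
    then show ?thesis by (auto intro: span_sum span_scale span_base)
  qed
  ultimately show "form_basis (metric_in_chart M g c p) ((\<lambda>v. v c) ` B)"
    using fin unfolding form_basis_def by blast
qed

lemma orthonormal_basis_coord_tvec:
  assumes M: "differentiable_atlas M" and c: "c \<in> charts_at M p"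
    and b: "pos_def_form (metric_in_chart M g c p)" and C: "form_basis (metric_in_chart M g c p) C"
  shows "orthonormal_basis M g p (coord_tvec M c p ` C)"
proof -
  let ?b = "metric_in_chart M g c p" and ?t = "coord_tvec M c p"
  note l = linear_coord_tvec[OF M c]
  have inj: "inj ?t" by (rule inj_on_inverseI[of _ "\<lambda>v. v c"]) (rule coord_tvec_self[OF M c])
  have "v = (\<lambda>c'. \<Sum>u\<in>?t ` C. ?b (v c) (u c) *\<^sub>R u c')" if v: "v \<in> tangent_space M p" for v
  proof
    fix c'
    have "v c' = ?t (v c) c'" using coord_tvec_eq[OF v c] by simp
    also have "\<dots> = ?t (\<Sum>x\<in>C. ?b (v c) x *\<^sub>R x) c'"
      using form_basis_expansion[OF b C, of "v c"] by simp
    also have "\<dots> = (\<Sum>x\<in>C. ?b (v c) x *\<^sub>R ?t x c')"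
      by (simp add: linear_sum[OF l] linear_scale[OF l])
    also have "\<dots> = (\<Sum>u\<in>?t ` C. ?b (v c) (u c) *\<^sub>R u c')"
      using inj by (subst sum.reindex) (auto simp: inj_on_def coord_tvec_self[OF M c])
    finally show "v c' = (\<Sum>u\<in>?t ` C. ?b (v c) (u c) *\<^sub>R u c')" .
  qed
  then have "\<forall>v\<in>tangent_space M p. \<exists>a. v = (\<lambda>c'. \<Sum>u\<in>?t ` C. a u *\<^sub>R u c')"
    by (intro ballI exI)
  moreover have "g p (?t x) (?t y) = (if ?t x = ?t y then 1 else 0)" if "x \<in> C" "y \<in> C" for x y
    using C that inj_eq[OF inj] unfolding form_basis_def metric_in_chart_def by auto
  ultimately show ?thesis
    using C coord_tvec_in_tangent_space[OF M c] unfolding orthonormal_basis_def form_basis_def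
    by blast
qed

lemma charts_at_euclidean: "charts_at euclidean_mfd y = {(UNIV, id)}"
  by (auto simp: charts_at_def euclidean_mfd_def)

lemma mdiff_euclidean: "mdiff M euclidean_mfd f p v (UNIV, id) = vdiff M f p v"
  by (simp add: mdiff_def charts_at_euclidean)

lemma norm2_diff_eq:
  fixes f :: "'a \<Rightarrow> 'v::euclidean_space"
  assumes M: "differentiable_atlas M" and c: "c \<in> charts_at M p"
    and b: "pos_def_form (metric_in_chart M g c p)" and C: "form_basis (metric_in_chart M g c p) C"
    and f: "(f \<circ> chart_inv c) differentiable (at (snd c p))"
  shows "norm2_diff M g euclidean_mfd euclidean_rmetric f p =
     (\<Sum>u\<in>C. frechet_derivative (f \<circ> chart_inv c) (at (snd c p)) u \<bullet>
        frechet_derivative (f \<circ> chart_inv c) (at (snd c p)) u)"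
proof -
  let ?L = "frechet_derivative (f \<circ> chart_inv c) (at (snd c p))"
  define B where "B = (SOME B. orthonormal_basis M g p B)"
  have B: "orthonormal_basis M g p B"
    unfolding B_def using orthonormal_basis_coord_tvec[OF M c b C] by (rule someI)
  have v: "vdiff M f p e = ?L (e c)" if "e \<in> B" for e
    using vdiff_eq[OF M c _ f] that B unfolding orthonormal_basis_def by blast
  have "norm2_diff M g euclidean_mfd euclidean_rmetric f p =
      (\<Sum>e\<in>B. vdiff M f p e \<bullet> vdiff M f p e)"
    by (simp add: norm2_diff_def Let_def B_def euclidean_rmetric_def mdiff_euclidean)
  also have "\<dots> = (\<Sum>e\<in>B. ?L (e c) \<bullet> ?L (e c))" using v by (intro sum.cong) auto
  also have "\<dots> = (\<Sum>u\<in>(\<lambda>v. v c) ` B. ?L u \<bullet> ?L u)"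
    by (simp add: sum.reindex[OF orthonormal_basis_in_chart(2)[OF M c B]])
  also have "\<dots> = (\<Sum>u\<in>C. ?L u \<bullet> ?L u)"
    by (rule form_basis_trace_independent[OF b orthonormal_basis_in_chart(1)[OF M c B] C
          linear_frechet_derivative[OF f]])
  finally show ?thesis .
qed

text \<open>The gradient is tangent, and its coordinate vector represents the derivative of \<open>f\<close> in the chart;
  by \<open>pos_def_form_eqI\<close> the second property determines it.\<close>

lemma gradient_in_chart:
  assumes M: "differentiable_atlas M" and c: "c \<in> charts_at M p"
    and b: "pos_def_form (metric_in_chart M g c p)"
    and f: "(f \<circ> chart_inv c) differentiable (at (snd c p))"
  shows "gradient M g f p \<in> tangent_space M p"
    and "metric_in_chart M g c p (gradient M g f p c) w =
      frechet_derivative (f \<circ> chart_inv c) (at (snd c p)) w"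
proof -
  let ?b = "metric_in_chart M g c p" and ?t = "coord_tvec M c p"
    and ?L = "frechet_derivative (f \<circ> chart_inv c) (at (snd c p))"
  let ?P = "\<lambda>v. v \<in> tangent_space M p \<and> (\<forall>w\<in>tangent_space M p. g p v w = vdiff M f p w)"
  have P: "?P v \<longleftrightarrow> v \<in> tangent_space M p \<and> (\<forall>w. ?b (v c) w = ?L w)" for v
  proof (cases "v \<in> tangent_space M p")
    case True
    have "(\<forall>w\<in>tangent_space M p. g p v w = vdiff M f p w) \<longleftrightarrow>
        (\<forall>w\<in>tangent_space M p. ?b (v c) (w c) = ?L (w c))"
      using metric_in_chart_eq[OF True _ c, of _ g] vdiff_eq[OF M c _ f] by simp
    also have "\<dots> \<longleftrightarrow> (\<forall>w. ?b (v c) w = ?L w)"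
    proof (intro iffI allI)
      fix w assume "\<forall>w\<in>tangent_space M p. ?b (v c) (w c) = ?L (w c)"
      from bspec[OF this coord_tvec_in_tangent_space[OF M c, of w]]
      show "?b (v c) w = ?L w" by (simp only: coord_tvec_self[OF M c])
    qed simp
    finally show ?thesis using True by simp
  qed simp
  obtain B where "form_basis ?b B" using ex_form_basis[OF b] by blast
  then have "\<exists>!x. \<forall>w. ?b x w = ?L w" by (rule form_riesz[OF b _ linear_frechet_derivative[OF f]])
  then obtain x where x: "\<forall>w. ?b x w = ?L w" "\<And>y. \<forall>w. ?b y w = ?L w \<Longrightarrow> y = x"
    by (elim ex1E) blast
  have "\<exists>!v. ?P v"
  proof (rule ex1I)
    show "?P (?t x)"
      unfolding P using x(1) coord_tvec_in_tangent_space[OF M c] by (simp add: coord_tvec_self[OF M c])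
    show "v = ?t x" if "?P v" for v
      using that x(2)[of "v c"] coord_tvec_eq[of v M p c] c unfolding P by simp
  qed
  then have "?P (gradient M g f p)" unfolding gradient_def by (rule theI')
  then have "gradient M g f p \<in> tangent_space M p \<and> (\<forall>w. ?b (gradient M g f p c) w = ?L w)"
    unfolding P .
  then show "gradient M g f p \<in> tangent_space M p" and "?b (gradient M g f p c) w = ?L w"
    by simp_all
qed

section \<open>Differentiability of the energy density\<close>

lemma Ck_on_cong:
  assumes "open S" "\<And>x. x \<in> S \<Longrightarrow> f x = g x" "Ck_on k S f"
  shows "Ck_on k S g"
  using assms(2,3)
proof (induction k arbitrary: f g)
  case 0
  then show ?case using continuous_on_cong[of S S f g] by simp
next
  case (Suc k)
  have eq: "\<And>x. x \<in> S \<Longrightarrow> f x = g x" and f: "\<And>x. x \<in> S \<Longrightarrow> f differentiable (at x)"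
    and df: "\<And>v. Ck_on k S (\<lambda>x. frechet_derivative f (at x) v)"
    using Suc.prems unfolding Ck_on.simps by blast+
  have "g differentiable (at x)" if "x \<in> S" for x
    by (rule differentiable_transform_open[OF f[OF that] assms(1) that eq])
  moreover have "Ck_on k S (\<lambda>x. frechet_derivative g (at x) v)" for v
    by (rule Suc.IH[OF fun_cong[OF frechet_derivative_transform_within_open[OF f assms(1) _ eq]] df])
  ultimately show ?case by simp
qed

lemma frechet_derivative_plus:
  assumes "f differentiable (at x)" "g differentiable (at x)"
  shows "frechet_derivative (\<lambda>x. f x + g x) (at x) v =
    frechet_derivative f (at x) v + frechet_derivative g (at x) v"
  using frechet_derivative_at[OF has_derivative_add[OF assms[unfolded frechet_derivative_works]]]
  by metis

lemma Ck_on_add: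
  assumes "open S" "Ck_on k S f" "Ck_on k S g"
  shows "Ck_on k S (\<lambda>x. f x + g x)"
  using assms(2,3)
proof (induction k arbitrary: f g)
  case 0
  then show ?case by (simp add: continuous_on_add)
next
  case (Suc k)
  have "Ck_on k S (\<lambda>x. frechet_derivative (\<lambda>x. f x + g x) (at x) v)" for v
    by (rule Ck_on_cong[OF assms(1) _ Suc.IH[of "\<lambda>x. frechet_derivative f (at x) v"
            "\<lambda>x. frechet_derivative g (at x) v"]])
      (use Suc.prems in \<open>auto simp: frechet_derivative_plus\<close>)
  then show ?case using Suc.prems by simp
qed

lemma compose_bounded_linear_derivative:
  assumes "f differentiable (at (L x))" "bounded_linear L"
  shows "(\<lambda>x. f (L x)) differentiable (at x)"
    and "frechet_derivative (\<lambda>x. f (L x)) (at x) v = frechet_derivative f (at (L x)) (L v)"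
proof -
  have "((\<lambda>x. f (L x)) has_derivative (\<lambda>v. frechet_derivative f (at (L x)) (L v))) (at x)"
    using has_derivative_compose[OF bounded_linear_imp_has_derivative[OF assms(2)]
        assms(1)[unfolded frechet_derivative_works]] .
  then show "(\<lambda>x. f (L x)) differentiable (at x)"
    "frechet_derivative (\<lambda>x. f (L x)) (at x) v = frechet_derivative f (at (L x)) (L v)"
    using frechet_derivative_at by (blast intro: differentiableI, metis)
qed

lemma Ck_on_compose_linear:
  assumes L: "bounded_linear L" and S: "open S" "L ` S \<subseteq> T" and f: "Ck_on k T f"
  shows "Ck_on k S (\<lambda>x. f (L x))"
  using f
proof (induction k arbitrary: f)
  case 0
  then show ?case
    using S(2) linear_continuous_on[OF L, of S]
    by (simp add: continuous_on_compose2)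
next
  case (Suc k)
  have f: "f differentiable (at (L x))" if "x \<in> S" for x using that Suc.prems S(2) by auto
  have "Ck_on k S (\<lambda>x. frechet_derivative (\<lambda>x. f (L x)) (at x) v)" for v
    by (rule Ck_on_cong[OF S(1) _ Suc.IH[of "\<lambda>x. frechet_derivative f (at x) (L v)"]])
      (use Suc.prems in \<open>auto simp: compose_bounded_linear_derivative(2)[OF f L]\<close>)
  then show ?case using compose_bounded_linear_derivative(1)[OF f L] by simp
qed

lemma Ck_map_euclidean_chart:
  assumes "Ck_map k M euclidean_mfd f" "c \<in> atlas M"
  shows "Ck_on k (snd c ` fst c) (f \<circ> chart_inv c)"
  using assms by (force simp: Ck_map_def euclidean_mfd_def o_def)

lemma open_chart_image:
  assumes "differentiable_atlas M" "c \<in> atlas M"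
  shows "open (snd c ` fst c)"
  using assms unfolding differentiable_atlas_def by (metis inf.idem)

lemma Ck_map_chart_differentiable:
  assumes f: "Ck_map 2 M euclidean_mfd f" and c: "c \<in> charts_at M p"
  shows "(f \<circ> chart_inv c) differentiable (at (snd c p))"
    and "(\<lambda>x. frechet_derivative (f \<circ> chart_inv c) (at x) v) differentiable (at (snd c p))"
  using Ck_map_euclidean_chart[OF f charts_atD(1)[OF c]] charts_atD(2)[OF c]
  by (simp_all add: numeral_2_eq_2)

lemma riemannian_manifoldD:
  assumes "riemannian_manifold M g"
  shows "differentiable_atlas M"
    and "p \<in> topspace (mtop M) \<Longrightarrow> \<exists>c. c \<in> charts_at M p"
    and "c \<in> charts_at M p \<Longrightarrow> pos_def_form (metric_in_chart M g c p)"
proof -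
  have M: "smooth_manifold M" using assms by (simp add: riemannian_manifold_def)
  then have u: "(\<Union>c\<in>atlas M. fst c) = topspace (mtop M)" by (simp add: smooth_manifold_def)
  show d: "differentiable_atlas M" by (rule smooth_manifold_differentiable_atlas[OF M])
  show "\<exists>c. c \<in> charts_at M p" if "p \<in> topspace (mtop M)"
    using that u[symmetric] by (auto simp: charts_at_def)
  show "pos_def_form (metric_in_chart M g c p)" if "c \<in> charts_at M p"
  proof (rule pos_def_metric_in_chart[OF d that])
    have "p \<in> topspace (mtop M)" using that u by (auto simp: charts_at_def)
    then show "inner_product_on (tangent_space M p) (g p)"
      using assms by (simp add: riemannian_manifold_def)
  qed
qed

text \<open>With a differentiable orthonormal frame \<open>E a\<close>, the energy density in the chart is
  \<open>\<Sum>\<^sub>a |DF(z)(E a z)|\<^sup>2\<close> for \<open>F = f \<circ> chart_inv c\<close>; it is differentiable since \<open>DF\<close> is.\<close>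

lemma norm2_diff_differentiable:
  fixes f :: "'a \<Rightarrow> 'v::euclidean_space"
    and M :: "('a, 'e::euclidean_space) mfd"
  assumes R: "riemannian_manifold M g" and f: "Ck_map 2 M euclidean_mfd f"
    and c: "c \<in> charts_at M p"
  shows "(norm2_diff M g euclidean_mfd euclidean_rmetric f \<circ> chart_inv c)
           differentiable (at (snd c p))"
proof -
  note M = riemannian_manifoldD(1)[OF R]
  let ?S = "snd c ` fst c" and ?F = "f \<circ> chart_inv c"
    and ?b = "\<lambda>z. metric_in_chart M g c (chart_inv c z)"
  have inj: "inj_on (snd c) (fst c)" using differentiable_atlasD(1)[OF M c c] .
  have S: "open ?S" "snd c p \<in> ?S" using open_chart_image[OF M] charts_atD[OF c] by auto
  have z: "c \<in> charts_at M (chart_inv c z)" "snd c (chart_inv c z) = z" if "z \<in> ?S" for z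
    using that c by (auto simp: charts_at_def chart_inv_image[OF inj])
  have b: "pos_def_form (?b z)" if "z \<in> ?S" for z
    using riemannian_manifoldD(3)[OF R z(1)[OF that]] .
  have d: "(\<lambda>z. ?b z x y) differentiable (at z)" if "z \<in> ?S" for x y z
  proof -
    have "smooth_metric M g" using R by (simp add: riemannian_manifold_def)
    then have "Ck_on (Suc 0) ?S (\<lambda>z. ?b z x y)"
      using charts_atD(1)[OF c]
      unfolding smooth_metric_def smooth_on_def metric_in_chart_def Let_def by blast
    then show ?thesis using that unfolding Ck_on.simps by blast
  qed
  obtain E :: "'e \<Rightarrow> 'e \<Rightarrow> 'e" where
      E: "\<And>z a. z \<in> ?S \<Longrightarrow> a \<in> Basis \<Longrightarrow> E a differentiable (at z)"
    and injE: "\<And>z. z \<in> ?S \<Longrightarrow> inj_on (\<lambda>a. E a z) Basis"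
    and fb: "\<And>z. z \<in> ?S \<Longrightarrow> form_basis (?b z) ((\<lambda>a. E a z) ` Basis)"
    using differentiable_form_basis[of ?S ?b, OF S(1) b d] by metis
  \<comment> \<open>Only the derivatives in fixed directions are known to be differentiable, so \<open>DF(z)(E a z)\<close> is
    expanded in the standard basis.\<close>
  let ?D = "\<lambda>a z. \<Sum>i\<in>Basis. (E a z \<bullet> i) *\<^sub>R frechet_derivative ?F (at z) i"
  have "?D a differentiable (at (snd c p))" if "a \<in> Basis" for a
    using E[OF S(2) that] Ck_map_chart_differentiable(2)[OF f c]
    by (intro differentiable_sum differentiable_scaleR differentiable_inner ballI) auto
  then have diff: "(\<lambda>z. \<Sum>a\<in>Basis. ?D a z \<bullet> ?D a z) differentiable (at (snd c p))"
    by (intro differentiable_sum[OF finite_Basis ballI]) (rule differentiable_inner)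
  have eq: "(\<Sum>a\<in>Basis. ?D a z \<bullet> ?D a z) =
      (norm2_diff M g euclidean_mfd euclidean_rmetric f \<circ> chart_inv c) z" if "z \<in> ?S" for z
  proof -
    have F: "?F differentiable (at z)"
      using Ck_map_chart_differentiable(1)[OF f z(1)[OF that]] z(2)[OF that] by simp
    note l = linear_frechet_derivative[OF F]
    have D: "?D a z = frechet_derivative ?F (at z) (E a z)" for a
    proof -
      have "frechet_derivative ?F (at z) (\<Sum>i\<in>Basis. (E a z \<bullet> i) *\<^sub>R i) = ?D a z"
        by (simp only: linear_sum[OF l] linear_scale[OF l])
      then show ?thesis by (simp only: euclidean_representation)
    qed
    show ?thesis
      using norm2_diff_eq[OF M z(1)[OF that] b[OF that] fb[OF that], of f] F z(2)[OF that]
      by (simp add: D sum.reindex[OF injE[OF that]])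
  qed
  show ?thesis by (rule differentiable_transform_open[OF diff S eq])
qed

lemma infinity_harmonic_condition_in_chart:
  assumes "differentiable_atlas M" "c \<in> charts_at M p" "v \<in> tangent_space M p"
    and "(f \<circ> chart_inv c) differentiable (at (snd c p))"
  shows "(\<lambda>d. (1/2) *\<^sub>R mdiff M euclidean_mfd f p v d) = (\<lambda>_. 0) \<longleftrightarrow>
     frechet_derivative (f \<circ> chart_inv c) (at (snd c p)) (v c) = 0"
proof -
  have "mdiff M euclidean_mfd f p v d =
      (if d = (UNIV, id) then frechet_derivative (f \<circ> chart_inv c) (at (snd c p)) (v c) else 0)" for d
    using vdiff_eq[OF assms] by (simp add: mdiff_euclidean) (simp add: mdiff_def charts_at_euclidean)
  then show ?thesis by (auto simp: fun_eq_iff)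
qed

section \<open>Products and direct sums\<close>

lemma prod_chart_at:
  assumes "c \<in> charts_at M p" "d \<in> charts_at N q"
  shows "prod_chart c d \<in> charts_at (prod_mfd M N) (p, q)"
proof -
  have "prod_chart c d \<in> atlas (prod_mfd M N)"
    using assms unfolding prod_mfd_def charts_at_def by (simp del: split_paired_Ex) blast
  then show ?thesis using assms by (simp add: charts_at_def prod_chart_def)
qed

lemma snd_prod_chart: "snd (prod_chart c d) (p, q) = (snd c p, snd d q)"
  by (simp add: prod_chart_def)

lemma chart_inv_prod_chart:
  assumes "inj_on (snd c) (fst c)" "inj_on (snd d) (fst d)"
    and "z \<in> (snd c ` fst c) \<times> (snd d ` fst d)"
  shows "chart_inv (prod_chart c d) z = (chart_inv c (fst z), chart_inv d (snd z))"
proof -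
  obtain p q where "p \<in> fst c" "q \<in> fst d" "z = snd (prod_chart c d) (p, q)"
    using assms(3) by (auto simp: snd_prod_chart)
  moreover have "inj_on (snd (prod_chart c d)) (fst (prod_chart c d))"
    using assms(1,2) by (auto simp: prod_chart_def inj_on_def)
  ultimately show ?thesis
    using chart_inv_image[OF assms(1)] chart_inv_image[OF assms(2)]
      chart_inv_image[of "prod_chart c d" "(p, q)"]
    by (simp add: snd_prod_chart) (simp add: prod_chart_def)
qed

lemma differentiable_atlas_prod:
  assumes M: "differentiable_atlas M" and N: "differentiable_atlas N"
  shows "differentiable_atlas (prod_mfd M N)"
  unfolding differentiable_atlas_def
proof (intro conjI ballI)
  have at: "\<exists>c\<in>atlas M. \<exists>d\<in>atlas N. k = prod_chart c d" if "k \<in> atlas (prod_mfd M N)" for k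
    using that by (auto simp: prod_mfd_def)
  fix k assume "k \<in> atlas (prod_mfd M N)"
  then obtain c d where k: "c \<in> atlas M" "d \<in> atlas N" "k = prod_chart c d" using at by blast
  have inj: "inj_on (snd c) (fst c)" "inj_on (snd d) (fst d)"
    using M N k by (auto simp: differentiable_atlas_def)
  then show "inj_on (snd k) (fst k)" by (auto simp: k prod_chart_def inj_on_def)
  fix k' assume "k' \<in> atlas (prod_mfd M N)"
  then obtain c' d' where k': "c' \<in> atlas M" "d' \<in> atlas N" "k' = prod_chart c' d'" using at by blast
  let ?A = "snd c ` (fst c \<inter> fst c')" and ?B = "snd d ` (fst d \<inter> fst d')"
  have S: "snd k ` (fst k \<inter> fst k') = ?A \<times> ?B"
    by (force simp: k k' prod_chart_def)
  have oA: "open ?A" and oB: "open ?B" using M N k k' by (auto simp: differentiable_atlas_def)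
  then show o: "open (snd k ` (fst k \<inter> fst k'))" unfolding S by (rule open_Times)
  fix z assume "z \<in> snd k ` (fst k \<inter> fst k')"
  then have z: "z \<in> ?A \<times> ?B" unfolding S .
  have "transition c c' differentiable (at (fst z))" "transition d d' differentiable (at (snd z))"
    using M N k k' z by (auto simp: differentiable_atlas_def)
  note T = compose_bounded_linear_derivative(1)[OF this(1) bounded_linear_fst]
    compose_bounded_linear_derivative(1)[OF this(2) bounded_linear_snd]
  have "(\<lambda>z. (transition c c' (fst z), transition d d' (snd z))) differentiable (at z)"
    using has_derivative_Pair[OF T[unfolded frechet_derivative_works]] by (rule differentiableI)
  then show "transition k k' differentiable (at z)"
  proof (rule differentiable_transform_open[OF _ o[unfolded S] z])
    fix y assume "y \<in> ?A \<times> ?B"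
    then have "chart_inv k y = (chart_inv c (fst y), chart_inv d (snd y))"
      unfolding k by (intro chart_inv_prod_chart inj) auto
    then show "(transition c c' (fst y), transition d d' (snd y)) = transition k k' y"
      by (simp add: transition_def k' snd_prod_chart)
  qed
qed

text \<open>In a product chart, the projections of the product split a coordinate vector into its components.\<close>

lemma mdiff_projections:
  assumes M: "differentiable_atlas M" and N: "differentiable_atlas N"
    and c: "c \<in> charts_at M p" and d: "d \<in> charts_at N q"
    and u: "u \<in> tangent_space (prod_mfd M N) (p, q)"
  shows "mdiff (prod_mfd M N) M fst (p, q) u = coord_tvec M c p (fst (u (prod_chart c d)))"
    and "mdiff (prod_mfd M N) N snd (p, q) u = coord_tvec N d q (snd (u (prod_chart c d)))"
proof -
  let ?k = "prod_chart c d"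
  note P = differentiable_atlas_prod[OF M N] and k = prod_chart_at[OF c d]
  have inj: "inj_on (snd c) (fst c)" "inj_on (snd d) (fst d)"
    using differentiable_atlasD(1)[OF M c c] differentiable_atlasD(1)[OF N d d] .
  have o: "open ((snd c ` fst c) \<times> (snd d ` fst d))"
    by (intro open_Times open_chart_image[OF M] open_chart_image[OF N] charts_atD(1)[OF c] charts_atD(1)[OF d])
  have mem: "snd ?k (p, q) \<in> (snd c ` fst c) \<times> (snd d ` fst d)"
    using charts_atD(2)[OF c] charts_atD(2)[OF d] by (simp add: snd_prod_chart)
  note inv = chart_inv_prod_chart[OF inj]
  show "mdiff (prod_mfd M N) M fst (p, q) u = coord_tvec M c p (fst (u ?k))"
  proof
    fix c'
    show "mdiff (prod_mfd M N) M fst (p, q) u c' = coord_tvec M c p (fst (u ?k)) c'"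
    proof (cases "c' \<in> charts_at M p")
      case True
      have "transition c c' differentiable (at (fst (snd ?k (p, q))))"
        using differentiable_atlasD(4)[OF M c True] by (simp add: snd_prod_chart)
      note T = compose_bounded_linear_derivative[OF this bounded_linear_fst]
      have eq: "transition c c' (fst y) = ((snd c' \<circ> fst) \<circ> chart_inv ?k) y"
        if "y \<in> (snd c ` fst c) \<times> (snd d ` fst d)" for y
        using inv[OF that] by (simp add: transition_def)
      have "((snd c' \<circ> fst) \<circ> chart_inv ?k) differentiable (at (snd ?k (p, q)))"
        by (rule differentiable_transform_open[OF T(1) o mem eq])
      note vdiff_eq[OF P k u this]
      also have "frechet_derivative ((snd c' \<circ> fst) \<circ> chart_inv ?k) (at (snd ?k (p, q))) =
          frechet_derivative (\<lambda>y. transition c c' (fst y)) (at (snd ?k (p, q)))"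
        by (rule frechet_derivative_transform_within_open[OF T(1) o mem eq, symmetric])
      also note T(2)
      finally show ?thesis
        by (simp only: mdiff_def coord_tvec_def snd_prod_chart fst_conv snd_conv True if_True)
    qed (simp add: mdiff_def coord_tvec_def)
  qed
  show "mdiff (prod_mfd M N) N snd (p, q) u = coord_tvec N d q (snd (u ?k))"
  proof
    fix d'
    show "mdiff (prod_mfd M N) N snd (p, q) u d' = coord_tvec N d q (snd (u ?k)) d'"
    proof (cases "d' \<in> charts_at N q")
      case True
      have "transition d d' differentiable (at (snd (snd ?k (p, q))))"
        using differentiable_atlasD(4)[OF N d True] by (simp add: snd_prod_chart)
      note T = compose_bounded_linear_derivative[OF this bounded_linear_snd]
      have eq: "transition d d' (snd y) = ((snd d' \<circ> snd) \<circ> chart_inv ?k) y"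
        if "y \<in> (snd c ` fst c) \<times> (snd d ` fst d)" for y
        using inv[OF that] by (simp add: transition_def)
      have "((snd d' \<circ> snd) \<circ> chart_inv ?k) differentiable (at (snd ?k (p, q)))"
        by (rule differentiable_transform_open[OF T(1) o mem eq])
      note vdiff_eq[OF P k u this]
      also have "frechet_derivative ((snd d' \<circ> snd) \<circ> chart_inv ?k) (at (snd ?k (p, q))) =
          frechet_derivative (\<lambda>y. transition d d' (snd y)) (at (snd ?k (p, q)))"
        by (rule frechet_derivative_transform_within_open[OF T(1) o mem eq, symmetric])
      also note T(2)
      finally show ?thesis
        by (simp only: mdiff_def coord_tvec_def snd_prod_chart fst_conv snd_conv True if_True)
    qed (simp add: mdiff_def coord_tvec_def)
  qed
qed

text \<open>In a product chart, the product metric is the orthogonal sum of the two metrics.\<close>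

lemma metric_in_chart_prod:
  assumes M: "differentiable_atlas M" and N: "differentiable_atlas N"
    and c: "c \<in> charts_at M p" and d: "d \<in> charts_at N q"
  shows "metric_in_chart (prod_mfd M N) (prod_rmetric M g N h) (prod_chart c d) (p, q) =
     (\<lambda>x y. metric_in_chart M g c p (fst x) (fst y) + metric_in_chart N h d q (snd x) (snd y))"
  using mdiff_projections[OF assms] coord_tvec_in_tangent_space[OF differentiable_atlas_prod[OF M N] prod_chart_at[OF c d]]
    coord_tvec_self[OF differentiable_atlas_prod[OF M N] prod_chart_at[OF c d]]
  by (intro ext) (simp add: metric_in_chart_def prod_rmetric_def)

lemma direct_sum_in_chart:
  fixes f :: "'a \<Rightarrow> 'v::real_normed_vector"
  assumes M: "differentiable_atlas M" and N: "differentiable_atlas N"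
    and c: "c \<in> charts_at M p" and d: "d \<in> charts_at N q"
    and f: "(f \<circ> chart_inv c) differentiable (at (snd c p))"
    and k: "(k \<circ> chart_inv d) differentiable (at (snd d q))"
  shows "(direct_sum f k \<circ> chart_inv (prod_chart c d))
      differentiable (at (snd (prod_chart c d) (p, q)))"
    and "frechet_derivative (direct_sum f k \<circ> chart_inv (prod_chart c d))
        (at (snd (prod_chart c d) (p, q))) w =
      frechet_derivative (f \<circ> chart_inv c) (at (snd c p)) (fst w) +
      frechet_derivative (k \<circ> chart_inv d) (at (snd d q)) (snd w)"
proof -
  let ?z = "snd (prod_chart c d) (p, q)"
  have inj: "inj_on (snd c) (fst c)" "inj_on (snd d) (fst d)"
    using differentiable_atlasD(1)[OF M c c] differentiable_atlasD(1)[OF N d d] .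
  have o: "open ((snd c ` fst c) \<times> (snd d ` fst d))"
    by (intro open_Times open_chart_image[OF M] open_chart_image[OF N] charts_atD(1)[OF c] charts_atD(1)[OF d])
  have mem: "?z \<in> (snd c ` fst c) \<times> (snd d ` fst d)"
    using charts_atD(2)[OF c] charts_atD(2)[OF d] by (simp add: snd_prod_chart)
  have f': "(f \<circ> chart_inv c) differentiable (at (fst ?z))"
    and k': "(k \<circ> chart_inv d) differentiable (at (snd ?z))"
    using f k by (simp_all add: snd_prod_chart)
  note Df = compose_bounded_linear_derivative[OF f' bounded_linear_fst]
    and Dk = compose_bounded_linear_derivative[OF k' bounded_linear_snd]
  have eq: "(f \<circ> chart_inv c) (fst y) + (k \<circ> chart_inv d) (snd y) =
      (direct_sum f k \<circ> chart_inv (prod_chart c d)) y"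
    if "y \<in> (snd c ` fst c) \<times> (snd d ` fst d)" for y
    using chart_inv_prod_chart[OF inj that] by (simp add: direct_sum_def)
  note D = differentiable_add[OF Df(1) Dk(1)]
  show "(direct_sum f k \<circ> chart_inv (prod_chart c d)) differentiable (at ?z)"
    by (rule differentiable_transform_open[OF D o mem eq])
  have "frechet_derivative (direct_sum f k \<circ> chart_inv (prod_chart c d)) (at ?z) w =
      frechet_derivative (\<lambda>y. (f \<circ> chart_inv c) (fst y) + (k \<circ> chart_inv d) (snd y)) (at ?z) w"
    by (rule fun_cong, rule frechet_derivative_transform_within_open[OF D o mem eq, symmetric])
  also note frechet_derivative_plus[OF Df(1) Dk(1)]
  also note Df(2)
  also note Dk(2)
  finally show "frechet_derivative (direct_sum f k \<circ> chart_inv (prod_chart c d)) (at ?z) w =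
      frechet_derivative (f \<circ> chart_inv c) (at (snd c p)) (fst w) +
      frechet_derivative (k \<circ> chart_inv d) (at (snd d q)) (snd w)"
    by (simp only: snd_prod_chart fst_conv snd_conv)
qed

lemma Ck_map_direct_sum:
  fixes f :: "'a \<Rightarrow> 'v::euclidean_space" and k :: "'b \<Rightarrow> 'v"
    and M :: "('a, 'e::euclidean_space) mfd" and N :: "('b, 'f::euclidean_space) mfd"
  assumes M: "differentiable_atlas M" and N: "differentiable_atlas N"
    and f: "Ck_map n M euclidean_mfd f" and k: "Ck_map n N euclidean_mfd k"
  shows "Ck_map n (prod_mfd M N) euclidean_mfd (direct_sum f k)"
  unfolding Ck_map_def
proof (intro conjI ballI)
  have "continuous_map (mtop M) euclidean f" "continuous_map (mtop N) euclidean k"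
    using f k by (auto simp: Ck_map_def euclidean_mfd_def)
  note this[THEN continuous_map_compose[rotated]]
  from this(1)[OF continuous_map_fst] this(2)[OF continuous_map_snd]
  have "continuous_map (prod_topology (mtop M) (mtop N)) euclidean (\<lambda>x. f (fst x) + k (snd x))"
    by (intro continuous_map_add) (simp_all only: o_def)
  moreover have "direct_sum f k = (\<lambda>x. f (fst x) + k (snd x))"
    by (auto simp: direct_sum_def)
  ultimately show "continuous_map (mtop (prod_mfd M N)) (mtop euclidean_mfd) (direct_sum f k)"
    by (simp add: prod_mfd_def euclidean_mfd_def)
next
  fix ch :: "('a \<times> 'b, 'e \<times> 'f) chart" and e :: "('v, 'v) chart"
  assume "ch \<in> atlas (prod_mfd M N)" and e: "e \<in> atlas euclidean_mfd"
  then obtain c d where ch: "c \<in> atlas M" "d \<in> atlas N" "ch = prod_chart c d"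
    by (auto simp: prod_mfd_def)
  have inj: "inj_on (snd c) (fst c)" "inj_on (snd d) (fst d)"
    using M N ch by (auto simp: differentiable_atlas_def)
  let ?S = "(snd c ` fst c) \<times> (snd d ` fst d)"
  have S: "open ?S" using ch by (intro open_Times open_chart_image[OF M] open_chart_image[OF N])
  have "fst ` ?S \<subseteq> snd c ` fst c" "snd ` ?S \<subseteq> snd d ` fst d" by auto
  then have "Ck_on n ?S (\<lambda>z. (f \<circ> chart_inv c) (fst z) + (k \<circ> chart_inv d) (snd z))"
    by (intro Ck_on_add[OF S]
        Ck_on_compose_linear[OF bounded_linear_fst S _ Ck_map_euclidean_chart[OF f ch(1)]]
        Ck_on_compose_linear[OF bounded_linear_snd S _ Ck_map_euclidean_chart[OF k ch(2)]])
  then have "Ck_on n ?S (direct_sum f k \<circ> chart_inv ch)"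
    by (rule Ck_on_cong[OF S, rotated])
      (simp add: ch(3) chart_inv_prod_chart[OF inj] direct_sum_def)
  moreover have "snd ch ` fst ch = ?S" by (force simp: ch prod_chart_def)
  ultimately show "Ck_on n (snd ch ` {p \<in> fst ch. direct_sum f k p \<in> fst e})
      (snd e \<circ> direct_sum f k \<circ> chart_inv ch)"
    using e by (simp add: euclidean_mfd_def)
qed

lemma norm2_diff_direct_sum:
  fixes f :: "'a \<Rightarrow> 'v::euclidean_space"
  assumes M: "riemannian_manifold M g" and N: "riemannian_manifold N h"
    and f: "Ck_map 2 M euclidean_mfd f" and k: "Ck_map 2 N euclidean_mfd k"
    and c: "c \<in> charts_at M p" and d: "d \<in> charts_at N q"
  shows "norm2_diff (prod_mfd M N) (prod_rmetric M g N h) euclidean_mfd euclidean_rmetric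
       (direct_sum f k) (p, q) =
     norm2_diff M g euclidean_mfd euclidean_rmetric f p +
     norm2_diff N h euclidean_mfd euclidean_rmetric k q"
proof -
  note M' = riemannian_manifoldD(1)[OF M] and N' = riemannian_manifoldD(1)[OF N]
  note bM = riemannian_manifoldD(3)[OF M c] and bN = riemannian_manifoldD(3)[OF N d]
  note F = Ck_map_chart_differentiable(1)[OF f c] and K = Ck_map_chart_differentiable(1)[OF k d]
  let ?DF = "frechet_derivative (f \<circ> chart_inv c) (at (snd c p))"
    and ?DK = "frechet_derivative (k \<circ> chart_inv d) (at (snd d q))"
  obtain B C where B: "form_basis (metric_in_chart M g c p) B"
    and C: "form_basis (metric_in_chart N h d q) C"
    using ex_form_basis[OF bM] ex_form_basis[OF bN] by blast
  let ?U = "(\<lambda>x. (x, 0)) ` B" and ?V = "(\<lambda>y. (0, y)) ` C"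
  have 0: "?DF 0 = 0" "?DK 0 = 0"
    using linear_0[OF linear_frechet_derivative[OF F]] linear_0[OF linear_frechet_derivative[OF K]] .
  have "norm2_diff (prod_mfd M N) (prod_rmetric M g N h) euclidean_mfd euclidean_rmetric
      (direct_sum f k) (p, q) =
     (\<Sum>u\<in>?U \<union> ?V. (?DF (fst u) + ?DK (snd u)) \<bullet> (?DF (fst u) + ?DK (snd u)))"
    using norm2_diff_eq[OF differentiable_atlas_prod[OF M' N'] prod_chart_at[OF c d]
        _ _ direct_sum_in_chart(1)[OF M' N' c d F K],
        of "prod_rmetric M g N h" "?U \<union> ?V"]
      pos_def_form_Times[OF bM bN] form_basis_Times[OF bM B bN C]
    by (simp only: metric_in_chart_prod[OF M' N' c d] direct_sum_in_chart(2)[OF M' N' c d F K])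
  also have "\<dots> = (\<Sum>u\<in>?U. (?DF (fst u) + ?DK (snd u)) \<bullet> (?DF (fst u) + ?DK (snd u))) +
      (\<Sum>u\<in>?V. (?DF (fst u) + ?DK (snd u)) \<bullet> (?DF (fst u) + ?DK (snd u)))"
  proof (rule sum.union_inter_neutral)
    show "finite ?U" "finite ?V" using B C by (auto simp: form_basis_def)
  qed (auto simp: 0)
  also have "\<dots> = (\<Sum>u\<in>B. ?DF u \<bullet> ?DF u) + (\<Sum>u\<in>C. ?DK u \<bullet> ?DK u)"
    by (simp add: sum.reindex inj_on_def 0)
  finally show ?thesis
    by (simp add: norm2_diff_eq[OF M' c bM B F] norm2_diff_eq[OF N' d bN C K])
qed

theorem proposition4p6:
  fixes M :: "('a, 'e::euclidean_space) mfd" and g :: "('a, 'e) metric"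
    and N :: "('b, 'f::euclidean_space) mfd" and h :: "('b, 'f) metric"
    and \<phi> :: "'a \<Rightarrow> real ^ 'n" and \<psi> :: "'b \<Rightarrow> real ^ 'n"
  assumes "riemannian_manifold M g" and "riemannian_manifold N h"
    and "infinity_harmonic M g euclidean_mfd euclidean_rmetric \<phi>"
    and "infinity_harmonic N h euclidean_mfd euclidean_rmetric \<psi>"
  shows "infinity_harmonic (prod_mfd M N) (prod_rmetric M g N h)
           euclidean_mfd euclidean_rmetric (direct_sum \<phi> \<psi>)"
proof -
  let ?e = "norm2_diff M g euclidean_mfd euclidean_rmetric \<phi>"
    and ?e' = "norm2_diff N h euclidean_mfd euclidean_rmetric \<psi>"
    and ?P = "prod_mfd M N" and ?G = "prod_rmetric M g N h"
  let ?E = "norm2_diff ?P ?G euclidean_mfd euclidean_rmetric (direct_sum \<phi> \<psi>)"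
  note M = riemannian_manifoldD(1)[OF assms(1)] and N = riemannian_manifoldD(1)[OF assms(2)]
  note P = differentiable_atlas_prod[OF M N]
  have f: "Ck_map 2 M euclidean_mfd \<phi>" and k: "Ck_map 2 N euclidean_mfd \<psi>"
    using assms(3,4) by (auto simp: infinity_harmonic_def)
  have "(\<lambda>ch. (1/2) *\<^sub>R mdiff ?P euclidean_mfd (direct_sum \<phi> \<psi>) (p, q) (gradient ?P ?G ?E (p, q)) ch)
      = (\<lambda>_. 0)" if p: "p \<in> topspace (mtop M)" and q: "q \<in> topspace (mtop N)" for p q
  proof -
    obtain c d where c: "c \<in> charts_at M p" and d: "d \<in> charts_at N q"
      using riemannian_manifoldD(2)[OF assms(1) p] riemannian_manifoldD(2)[OF assms(2) q] by blast
    let ?k = "prod_chart c d"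
    note kP = prod_chart_at[OF c d]
    note bM = riemannian_manifoldD(3)[OF assms(1) c] and bN = riemannian_manifoldD(3)[OF assms(2) d]
    note F = Ck_map_chart_differentiable(1)[OF f c] and K = Ck_map_chart_differentiable(1)[OF k d]
    note e = norm2_diff_differentiable[OF assms(1) f c]
      and e' = norm2_diff_differentiable[OF assms(2) k d]
    note FK = direct_sum_in_chart[OF M N c d F K] and ee = direct_sum_in_chart[OF M N c d e e']
    have bP: "pos_def_form (metric_in_chart ?P ?G ?k (p, q))"
      unfolding metric_in_chart_prod[OF M N c d] by (rule pos_def_form_Times[OF bM bN])
    have inj: "inj_on (snd ?k) (fst ?k)" and o: "open (snd ?k ` fst ?k)"
      and mem: "snd ?k (p, q) \<in> snd ?k ` fst ?k"
      using differentiable_atlasD[OF P kP kP] by auto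
    \<comment> \<open>The energy density is a direct sum on the whole chart domain, so derivatives agree as well.\<close>
    have eq: "(direct_sum ?e ?e' \<circ> chart_inv ?k) z = (?E \<circ> chart_inv ?k) z"
      if im: "z \<in> snd ?k ` fst ?k" for z
    proof -
      obtain x where x: "x \<in> fst ?k" "z = snd ?k x" using im by blast
      obtain p' q' where "x = (p', q')" by (rule prod.exhaust)
      with x have z: "p' \<in> fst c" "q' \<in> fst d" "z = snd ?k (p', q')"
        by (simp_all add: prod_chart_def)
      then have "c \<in> charts_at M p'" "d \<in> charts_at N q'" "chart_inv ?k z = (p', q')"
        using c d chart_inv_image[OF inj] by (auto simp: charts_at_def prod_chart_def)
      then show ?thesis
        using norm2_diff_direct_sum[OF assms(1,2) f k] by (simp add: direct_sum_def)
    qed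
    have E: "(?E \<circ> chart_inv ?k) differentiable (at (snd ?k (p, q)))"
      by (rule differentiable_transform_open[OF ee(1) o mem eq])
    have DE: "frechet_derivative (?E \<circ> chart_inv ?k) (at (snd ?k (p, q))) w =
        frechet_derivative (?e \<circ> chart_inv c) (at (snd c p)) (fst w) +
        frechet_derivative (?e' \<circ> chart_inv d) (at (snd d q)) (snd w)" for w
      using frechet_derivative_transform_within_open[OF ee(1) o mem eq] ee(2) by metis
    note gM = gradient_in_chart[OF M c bM e] and gN = gradient_in_chart[OF N d bN e']
      and gP = gradient_in_chart[OF P kP bP E]
    have grad: "gradient ?P ?G ?E (p, q) ?k = (gradient M g ?e p c, gradient N h ?e' q d)"
      by (rule pos_def_form_eqI[OF bP], rule trans[OF gP(2)])
        (simp only: DE metric_in_chart_prod[OF M N c d] fst_conv snd_conv gM(2) gN(2))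
    have "frechet_derivative (\<phi> \<circ> chart_inv c) (at (snd c p)) (gradient M g ?e p c) = 0"
      using assms(3) p unfolding infinity_harmonic_def infinity_harmonic_condition_in_chart[OF M c gM(1) F, symmetric]
      by blast
    moreover have "frechet_derivative (\<psi> \<circ> chart_inv d) (at (snd d q)) (gradient N h ?e' q d) = 0"
      using assms(4) q unfolding infinity_harmonic_def infinity_harmonic_condition_in_chart[OF N d gN(1) K, symmetric]
      by blast
    ultimately show ?thesis
      by (simp only: infinity_harmonic_condition_in_chart[OF P kP gP(1) FK(1)] FK(2) grad fst_conv snd_conv) simp
  qed
  then have "\<forall>x\<in>topspace (mtop ?P).
      (\<lambda>ch. (1/2) *\<^sub>R mdiff ?P euclidean_mfd (direct_sum \<phi> \<psi>) x (gradient ?P ?G ?E x) ch) = (\<lambda>_. 0)"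
    by (auto simp: prod_mfd_def topspace_prod_topology)
  then show ?thesis
    unfolding infinity_harmonic_def using Ck_map_direct_sum[OF M N f k] by blast
qed

end
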